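(* Let $k \ge 2$ be a fixed integer. For positive integers $m,n$, let $\Psi_{\mathsf{LR}} : \mathcal{F}^k_{n,m} \to \{0,1\}$ be the likelihood-ratio test $$\Psi_{\mathsf{LR}}(\phi) = \mathbf{1}\{Z(\phi) > \mathbf{E}_{\text{unif}}[Z]\}.$$ For any $\delta \in (0,1)$ there exists a constant $\bar C_{k,\delta} > 0$ such that, for all $m,n$ large enough (depending on $k,\delta$) with $m \ge \bar C_{k,\delta}\sqrt{n}$, $$\max\big\{\mathbf{P}_{\text{unif}}(\Psi_{\mathsf{LR}}(\phi)=1),\ \mathbf{P}_{\text{planted}}(\Psi_{\mathsf{LR}}(\phi)=0)\big\} \le \delta.$$
   Context: Formulas: for positive integers $n,m$ and a fixed positive integer $k$ (with $n \ge k$), $\mathcal{F}^k_{n,m}$ is the set of boolean formulas $\phi = \bigwedge_{i=1}^m C_i$ on $n$ variables $x_1,\dots,x_n$, where each clause $C_i = \ell_{i,1}\vee\dots\vee \ell_{i,k}$ is a disjunction of $k$ literals ($\ell_{i,j}\in\{x_1,\bar x_1,\dots,x_n,\bar x_n\}$) on $k$ distinct variables. The formula is regarded as a sequence of $m$ clauses (clauses may repeat), and there are $2^k\binom{n}{k}$ possible clauses up to the order of literals; each clause is given with its $k$ literals in a uniformly random order. $\mathcal{S}(\phi)\subset\{0,1\}^n$ is the set of assignments satisfying $\phi$, and $Z = Z(\phi) = |\mathcal{S}(\phi)|$. Distributions on $\mathcal{F}^k_{n,m}$: under $\mathbf{P}_{\text{unif}}$, the $m$ clauses are independent and uniform among the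 $2^k\binom{n}{k}$ possible clauses. For $x\in\{0,1\}^n$, under $\mathbf{P}_x$ the $m$ clauses are independent and uniform among the $(2^k-1)\binom{n}{k}$ clauses satisfied by $x$. The planted distribution is the mixture $\mathbf{P}_{\text{planted}} = 2^{-n}\sum_{x\in\{0,1\}^n}\mathbf{P}_x$. $\mathbf{E}_{\text{unif}}$ denotes expectation under $\mathbf{P}_{\text{unif}}$. *)

theory Defs
  imports "HOL-Probability.Probability" "HOL-Combinatorics.Multiset_Permutations"
begin

(* The literal (v, True) stands for x_v, and (v, False) for its negation. *)
type_synonym literal = "nat \<times> bool"

(* The order of the literals in a clause, and of the clauses in a formula, is part of the data. *)
type_synonym formula = "literal list list"

definition assignments :: "nat \<Rightarrow> (nat \<Rightarrow> bool) set" where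
  "assignments n = {1..n} \<rightarrow>\<^sub>E UNIV"

definition ordered_clauses :: "nat \<Rightarrow> nat \<Rightarrow> literal list set" where
  "ordered_clauses k n =
     {l. length l = k \<and> set l \<subseteq> {1..n} \<times> UNIV \<and> distinct (map fst l)}"

definition formulas :: "nat \<Rightarrow> nat \<Rightarrow> nat \<Rightarrow> formula set" where
  "formulas k n m = {\<phi>. length \<phi> = m \<and> set \<phi> \<subseteq> ordered_clauses k n}"

definition clause_sat :: "(nat \<Rightarrow> bool) \<Rightarrow> literal set \<Rightarrow> bool" where
  "clause_sat x c \<longleftrightarrow> (\<exists>(v, b)\<in>c. x v = b)"

definition sat_assignments :: "nat \<Rightarrow> formula \<Rightarrow> (nat \<Rightarrow> bool) set" where
  "sat_assignments n \<phi> = {x \<in> assignments n. \<forall>l\<in>set \<phi>. clause_sat x (set l)}"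

definition num_sat :: "nat \<Rightarrow> formula \<Rightarrow> nat" where
  "num_sat n \<phi> = card (sat_assignments n \<phi>)"

(* Clauses up to the order of their literals. *)
definition clauses :: "nat \<Rightarrow> nat \<Rightarrow> literal set set" where
  "clauses k n = {c. c \<subseteq> {1..n} \<times> UNIV \<and> card c = k \<and> inj_on fst c}"

definition satisfied_clauses :: "nat \<Rightarrow> nat \<Rightarrow> (nat \<Rightarrow> bool) \<Rightarrow> literal set set" where
  "satisfied_clauses k n x = {c \<in> clauses k n. clause_sat x c}"

(* m independent uniform clauses from C, each written in a uniformly random order.
   Meaningful only if C is finite and nonempty and its elements are finite. *)
definition random_formula :: "literal set set \<Rightarrow> nat \<Rightarrow> formula pmf" where
  "random_formula C m =
     replicate_pmf m (bind_pmf (pmf_of_set C) (\<lambda>c. pmf_of_set (permutations_of_set c)))"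

definition P_unif :: "nat \<Rightarrow> nat \<Rightarrow> nat \<Rightarrow> formula pmf" where
  "P_unif k n m = random_formula (clauses k n) m"

definition P_at :: "nat \<Rightarrow> nat \<Rightarrow> nat \<Rightarrow> (nat \<Rightarrow> bool) \<Rightarrow> formula pmf" where
  "P_at k n m x = random_formula (satisfied_clauses k n x) m"

definition P_planted :: "nat \<Rightarrow> nat \<Rightarrow> nat \<Rightarrow> formula pmf" where
  "P_planted k n m = bind_pmf (pmf_of_set (assignments n)) (P_at k n m)"

definition Psi_LR :: "nat \<Rightarrow> nat \<Rightarrow> nat \<Rightarrow> formula \<Rightarrow> nat" where
  "Psi_LR k n m \<phi> =
     (if real (num_sat n \<phi>) > measure_pmf.expectation (P_unif k n m) (\<lambda>\<psi>. real (num_sat n \<psi>))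
      then 1 else 0)"


lemma finite_assignments: "finite (assignments n)"
  by (simp add: assignments_def finite_PiE)

lemma card_assignments: "card (assignments n) = 2 ^ n"
  by (simp add: assignments_def card_PiE)

lemma finite_clauses: "finite (clauses k n)"
  by (rule finite_subset[of _ "Pow ({1..n} \<times> UNIV)"]) (auto simp: clauses_def)

lemma card_clauses: "card (clauses k n) = 2 ^ k * (n choose k)"
proof -
  let ?A = "SIGMA V:{V. V \<subseteq> {1..n} \<and> card V = k}. Pow V"
  let ?f = "\<lambda>(V, S). (\<lambda>v. (v, v \<in> S)) ` V :: literal set"
  let ?g = "\<lambda>c :: literal set. (fst ` c, {v. (v, True) \<in> c})"
  have "bij_betw ?f ?A (clauses k n)"
  proof (rule bij_betw_byWitness[where f' = ?g])
    show "\<forall>a\<in>?A. ?g (?f a) = a" by (auto simp: image_iff)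
    show "\<forall>c\<in>clauses k n. ?f (?g c) = c"
    proof
      fix c assume c: "c \<in> clauses k n"
      hence inj: "inj_on fst c" by (simp add: clauses_def)
      have "(v, (v, True) \<in> c) = (v, b)" if "(v, b) \<in> c" for v b
        using inj_onD[OF inj, of "(v, True)" "(v, b)"] that by (cases b) auto
      thus "?f (?g c) = c" by (force simp: image_iff)
    qed
    show "?f ` ?A \<subseteq> clauses k n"
      by (auto simp: clauses_def card_image inj_on_def)
    show "?g ` clauses k n \<subseteq> ?A"
      by (auto simp: clauses_def card_image) (force simp: image_iff)+
  qed
  hence "card (clauses k n) = card ?A" by (simp add: bij_betw_same_card)
  also have "\<dots> = (\<Sum>V | V \<subseteq> {1..n} \<and> card V = k. card (Pow V))"
    by (rule card_SigmaI) (auto dest: finite_subset[OF _ finite_atLeastAtMost])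
  also have "\<dots> = (\<Sum>V | V \<subseteq> {1..n} \<and> card V = k. 2 ^ k)"
    by (intro sum.cong) (auto simp: card_Pow dest: finite_subset[OF _ finite_atLeastAtMost])
  finally show ?thesis by (simp add: n_subsets mult.commute)
qed

lemma card_satisfied_clauses: "card (satisfied_clauses k n x) = (2 ^ k - 1) * (n choose k)"
proof -
  let ?U = "{c \<in> clauses k n. \<not> clause_sat x c}"
  let ?f = "\<lambda>V. (\<lambda>v. (v, \<not> x v)) ` V :: literal set"
  have "bij_betw ?f {V. V \<subseteq> {1..n} \<and> card V = k} ?U"
  proof (rule bij_betw_byWitness[where f' = "\<lambda>c. fst ` c"])
    show "\<forall>V\<in>{V. V \<subseteq> {1..n} \<and> card V = k}. fst ` ?f V = V"
      by (auto simp: image_iff)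
    show "\<forall>c\<in>?U. ?f (fst ` c) = c"
    proof
      fix c assume "c \<in> ?U"
      hence *: "(\<not> x v) = b" if "(v, b) \<in> c" for v b
        using that by (auto simp: clause_sat_def)
      show "?f (fst ` c) = c"
        unfolding image_image by (rule trans[OF image_cong[OF refl, of _ _ "\<lambda>l. l"]]) (auto dest: *)
    qed
    show "?f ` {V. V \<subseteq> {1..n} \<and> card V = k} \<subseteq> ?U"
      by (auto simp: clauses_def clause_sat_def card_image inj_on_def)
    show "(`) fst ` ?U \<subseteq> {V. V \<subseteq> {1..n} \<and> card V = k}"
      by (fastforce simp: clauses_def card_image)
  qed
  hence U: "card ?U = n choose k"
    using n_subsets[of "{1..n}" k] by (simp add: bij_betw_same_card[symmetric])
  have "satisfied_clauses k n x = clauses k n - ?U" by (auto simp: satisfied_clauses_def)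
  hence "card (satisfied_clauses k n x) = card (clauses k n) - card ?U"
    by (simp add: card_Diff_subset finite_clauses)
  thus ?thesis by (simp add: U card_clauses diff_mult_distrib)
qed

lemma set_pmf_random_formula:
  assumes "C \<subseteq> clauses k n" "C \<noteq> {}"
  shows "set_pmf (random_formula C m) =
           {\<phi> \<in> formulas k n m. \<forall>l\<in>set \<phi>. set l \<in> C}"
proof -
  have fin: "finite C" using assms finite_clauses finite_subset by blast
  have finc: "finite c" if "c \<in> C" for c
    using that assms(1) finite_subset[of c "{1..n} \<times> (UNIV :: bool set)"]
    unfolding clauses_def by fastforce
  have "set_pmf (bind_pmf (pmf_of_set C) (\<lambda>c. pmf_of_set (permutations_of_set c)))
        = (\<Union>c\<in>C. permutations_of_set c)"
    using fin finc assms by (auto simp: set_bind_pmf)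
  also have "\<dots> = {l \<in> ordered_clauses k n. set l \<in> C}"
    using assms(1)
    by (auto simp: permutations_of_set_def ordered_clauses_def clauses_def distinct_map
             simp flip: distinct_card)
  finally show ?thesis
    by (auto simp: random_formula_def set_replicate_pmf formulas_def)
qed

lemma set_pmf_P_unif: "k \<le> n \<Longrightarrow> set_pmf (P_unif k n m) = formulas k n m"
proof -
  assume "k \<le> n"
  hence "clauses k n \<noteq> {}"
    using card_clauses[of k n] by auto
  moreover have "set l \<in> clauses k n" if "l \<in> ordered_clauses k n" for l
    using that by (auto simp: clauses_def ordered_clauses_def distinct_map distinct_card)
  ultimately show ?thesis
    using set_pmf_random_formula[of "clauses k n" k n m]
    by (auto simp: P_unif_def formulas_def)
qed

lemma set_pmf_P_planted:
  assumes "1 \<le> k" "k \<le> n"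
  shows "set_pmf (P_planted k n m) \<subseteq> formulas k n m"
proof -
  have ne: "satisfied_clauses k n x \<noteq> {}" for x
  proof
    assume "satisfied_clauses k n x = {}"
    hence "(2 ^ k - 1 :: nat) * (n choose k) = 0"
      using card_satisfied_clauses[of k n x] by simp
    moreover have "(2::nat) ^ k > 1" using assms by (intro one_less_power) auto
    ultimately show False using assms by simp
  qed
  have "set_pmf (P_at k n m x) \<subseteq> formulas k n m" for x
    unfolding P_at_def
    by (subst set_pmf_random_formula[of _ k n]) (auto simp: ne, auto simp: satisfied_clauses_def)
  thus ?thesis by (auto simp: P_planted_def set_bind_pmf)
qed

end

theory Submission
  imports Defs
begin

text \<open>
  The density of the planted law with respect to the uniform one is proportional to the number of
  satisfying assignments, so by the Neyman--Pearson argument the likelihood-ratio test minimises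
  the sum of its two error probabilities. It therefore suffices to exhibit some other test with
  small errors. Look only at the first literal of each clause: its variable is uniform, and its
  sign is fair under the uniform law but, under the law planted at \<open>x\<close>, agrees with \<open>x\<close> with bias
  \<open>\<epsilon> = 1 / (2 ^ k - 1)\<close>, independently of the variable. Sum, over the pairs of clauses whose
  first literals share a variable, the product of the two signs. The mean is \<open>0\<close> in the uniform
  case and \<open>\<epsilon>\<^sup>2 m (m - 1) / (2 n)\<close> in the planted case, whatever \<open>x\<close> is, while the variance is of
  order \<open>m\<^sup>2 / n + m\<^sup>3 / n\<^sup>2\<close>; Chebyshev's inequality with the threshold at half the
  planted mean gives small errors once \<open>m\<close> is a large multiple of \<open>sqrt n\<close>.
\<close>

subsection \<open>Moments of the collision statistic\<close>

definition spin :: "bool \<Rightarrow> real" where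
  "spin b = (if b then 1 else -1)"

lemma spin_square [simp]: "spin b * spin b = 1" "(spin b)\<^sup>2 = 1" "spin b * (spin b * a) = a"
  by (auto simp: spin_def)

definition imbalance :: "nat \<Rightarrow> literal list \<Rightarrow> real" where
  "imbalance v ls = (\<Sum>l\<leftarrow>ls. if fst l = v then spin (snd l) else 0)"

(* Since spins square to 1, this is the sum over i < j of s_i s_j [v_i = v_j],
   where (v_i, s_i) are the variable and the spin of the i-th literal. *)
definition collision :: "nat \<Rightarrow> literal list \<Rightarrow> real" where
  "collision n ls = ((\<Sum>v\<in>{1..n}. (imbalance v ls)\<^sup>2) - real (length ls)) / 2"

text \<open>For literals with variables in \<open>{1..n}\<close>, this is the number satisfied by
  \<open>x\<close> minus the number falsified. The conditional mean of an increment of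
  \<open>collision\<close> is a multiple of it, so the moment recursions need it too.\<close>

definition alignment :: "nat \<Rightarrow> (nat \<Rightarrow> bool) \<Rightarrow> literal list \<Rightarrow> real" where
  "alignment n x ls = (\<Sum>v\<in>{1..n}. spin (x v) * imbalance v ls)"

text \<open>The sign agrees with \<open>x\<close> with probability
  \<open>(1 + \<epsilon>) / 2\<close>, whatever the variable. With \<epsilon> = 0 this is the
  uniform case, so one moment computation serves both laws.\<close>

definition biased_literal :: "nat \<Rightarrow> (nat \<Rightarrow> bool) \<Rightarrow> real \<Rightarrow> literal pmf \<Rightarrow> bool" where
  "biased_literal n x \<epsilon> p \<longleftrightarrow> n > 0 \<and> set_pmf p \<subseteq> {1..n} \<times> UNIV \<and>
     (\<forall>v\<in>{1..n}. \<forall>b. pmf p (v, b) = (1 + \<epsilon> * spin (x v) * spin b) / (2 * real n))"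

lemma collision_Nil [simp]: "collision n [] = 0"
  and alignment_Nil [simp]: "alignment n x [] = 0"
  by (simp_all add: collision_def alignment_def imbalance_def)

lemma imbalance_Cons:
  "imbalance v (l # ls) = (if fst l = v then spin (snd l) else 0) + imbalance v ls"
  by (simp add: imbalance_def)

text \<open>Only the square at \<open>fst l\<close> changes; its diagonal contribution 1 is
  cancelled by the growth of \<open>length\<close>.\<close>

lemma collision_Cons:
  assumes "fst l \<in> {1..n}"
  shows "collision n (l # ls) = collision n ls + spin (snd l) * imbalance (fst l) ls"
proof -
  have "(imbalance v (l # ls))\<^sup>2 = (imbalance v ls)\<^sup>2 +
      (if v = fst l then 2 * (spin (snd l) * imbalance (fst l) ls) + 1 else 0)" for v
    by (simp add: imbalance_Cons power2_sum)
  thus ?thesis using assms by (simp add: collision_def sum.distrib field_simps)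
qed

lemma alignment_Cons:
  assumes "fst l \<in> {1..n}"
  shows "alignment n x (l # ls) = alignment n x ls + spin (x (fst l)) * spin (snd l)"
proof -
  have "spin (x v) * imbalance v (l # ls) = spin (x v) * imbalance v ls +
      (if v = fst l then spin (x (fst l)) * spin (snd l) else 0)" for v
    by (simp add: imbalance_Cons algebra_simps)
  thus ?thesis using assms by (simp add: alignment_def sum.distrib)
qed

lemma sum_imbalance_square:
  "(\<Sum>v\<in>{1..n}. (imbalance v ls)\<^sup>2) = real (length ls) + 2 * collision n ls"
  by (simp add: collision_def field_simps)

section \<open>Averaging over independent sequences\<close>

lemma finite_set_replicate_pmf:
  "finite (set_pmf p) \<Longrightarrow> finite (set_pmf (replicate_pmf m p))"
  by (simp add: set_replicate_pmf lists_eq_set finite_lists_length_eq)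

text \<open>Conditioning on the tail; the moment recursions below are instances. Finite support
  turns both expectations into finite sums, which can be exchanged. The length is available in
  \<open>step\<close> because the mean squared increment of \<open>collision\<close> depends on
  it.\<close>

lemma expectation_replicate_pmf_Suc:
  fixes f :: "'a list \<Rightarrow> real"
  assumes fin: "finite (set_pmf p)"
    and step: "\<And>ls. set ls \<subseteq> set_pmf p \<Longrightarrow> length ls = m \<Longrightarrow>
                 measure_pmf.expectation p (\<lambda>l. f (l # ls)) = g ls"
  shows "measure_pmf.expectation (replicate_pmf (Suc m) p) f =
           measure_pmf.expectation (replicate_pmf m p) g"
proof -
  let ?S = "set_pmf (replicate_pmf m p)"
  have finS: "finite ?S" by (rule finite_set_replicate_pmf[OF fin])
  have "measure_pmf.expectation (replicate_pmf (Suc m) p) f =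
      (\<Sum>l\<in>set_pmf p. pmf p l * measure_pmf.expectation (replicate_pmf m p) (\<lambda>ls. f (l # ls)))"
    using fin finS
    by (simp add: pmf_expectation_bind[where A = "set_pmf p"] map_pmf_def[symmetric])
  also have "\<dots> = (\<Sum>l\<in>set_pmf p. pmf p l * (\<Sum>ls\<in>?S. f (l # ls) * pmf (replicate_pmf m p) ls))"
    by (simp add: integral_measure_pmf_real[OF finS])
  also have "\<dots> = (\<Sum>ls\<in>?S. (\<Sum>l\<in>set_pmf p. f (l # ls) * pmf p l) * pmf (replicate_pmf m p) ls)"
    unfolding sum_distrib_left sum_distrib_right by (subst sum.swap) (simp add: mult_ac)
  also have "\<dots> = (\<Sum>ls\<in>?S. g ls * pmf (replicate_pmf m p) ls)"
  proof (rule sum.cong[OF refl])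
    fix ls assume "ls \<in> ?S"
    hence "measure_pmf.expectation p (\<lambda>l. f (l # ls)) = g ls"
      by (intro step) (auto simp: set_replicate_pmf)
    thus "(\<Sum>l\<in>set_pmf p. f (l # ls) * pmf p l) * pmf (replicate_pmf m p) ls =
        g ls * pmf (replicate_pmf m p) ls"
      by (simp add: integral_measure_pmf_real[OF fin])
  qed
  also have "\<dots> = measure_pmf.expectation (replicate_pmf m p) g"
    by (simp add: integral_measure_pmf_real[OF finS])
  finally show ?thesis .
qed

lemma expectation_biased_literal:
  assumes "biased_literal n x \<epsilon> p"
  shows "measure_pmf.expectation p f =
    (\<Sum>v\<in>{1..n}. ((1 + \<epsilon> * spin (x v)) * f (v, True) + (1 - \<epsilon> * spin (x v)) * f (v, False))
       / (2 * real n))"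
proof -
  have "measure_pmf.expectation p f = (\<Sum>l\<in>{1..n} \<times> UNIV. f l * pmf p l)"
    using assms by (intro integral_measure_pmf_real) (auto simp: biased_literal_def)
  also have "\<dots> = (\<Sum>v\<in>{1..n}. \<Sum>b\<in>UNIV. f (v, b) * pmf p (v, b))"
    by (simp add: sum.cartesian_product)
  also have "\<dots> = (\<Sum>v\<in>{1..n}.
      ((1 + \<epsilon> * spin (x v)) * f (v, True) + (1 - \<epsilon> * spin (x v)) * f (v, False)) / (2 * real n))"
    using assms
    by (intro sum.cong refl)
       (simp add: biased_literal_def UNIV_bool spin_def add_divide_distrib
         diff_divide_distrib algebra_simps)
  finally show ?thesis .
qed

section \<open>Moments under a biased literal law\<close>

context
  fixes n :: nat and x :: "nat \<Rightarrow> bool" and \<epsilon> \<beta> :: real and p :: "literal pmf"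
  assumes p: "biased_literal n x \<epsilon> p" and \<beta>: "\<beta> = 1 / real n"
begin

lemma biased_literal_pos: "real n > 0" using p by (simp add: biased_literal_def)

lemma finite_biased_literal: "finite (set_pmf p)"
  using p finite_subset[of "set_pmf p" "{1..n} \<times> UNIV"] by (simp add: biased_literal_def)

lemma fst_biased_literal:
  assumes "l \<in> set_pmf p"
  shows "fst l \<in> {1..n}"
  using assms p by (auto simp: biased_literal_def)

text \<open>Lets the Cons rules for \<open>collision\<close> and \<open>alignment\<close>, which
  require a variable in \<open>{1..n}\<close>, be applied under the expectation.\<close>

lemma expectation_cong_literal:
  assumes "\<And>l. fst l \<in> {1..n} \<Longrightarrow> f l = (g l :: real)"
  shows "measure_pmf.expectation p f = measure_pmf.expectation p g"
  by (rule integral_cong_AE)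
     (auto simp: AE_measure_pmf_iff intro!: assms fst_biased_literal simp del: atLeastAtMost_iff)

lemma integrable_literal: "integrable (measure_pmf p) (f :: literal \<Rightarrow> real)"
  by (rule integrable_measure_pmf_finite[OF finite_biased_literal])

lemma integrable_literals:
  "integrable (measure_pmf (replicate_pmf m p)) (f :: literal list \<Rightarrow> real)"
  by (rule integrable_measure_pmf_finite[OF finite_set_replicate_pmf[OF finite_biased_literal]])

lemmas integrability = integrable_literal integrable_literals

lemma expectation_spin_alignment:
  "measure_pmf.expectation p (\<lambda>l. spin (x (fst l)) * spin (snd l)) = \<epsilon>"
proof -
  have "((1 + \<epsilon> * spin (x v)) * (spin (x v) * spin True)
        + (1 - \<epsilon> * spin (x v)) * (spin (x v) * spin False))
      / (2 * real n) = \<epsilon> / real n" for v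
    using biased_literal_pos by (cases "x v") (simp_all add: \<beta> spin_def field_simps)
  thus ?thesis using biased_literal_pos by (simp add: expectation_biased_literal[OF p])
qed

text \<open>Averaging over the sign leaves the bias \<open>\<epsilon> * spin (x v)\<close>;
  averaging over the uniform variable then assembles \<open>alignment\<close>.\<close>

lemma expectation_increment:
  "measure_pmf.expectation p (\<lambda>l. spin (snd l) * imbalance (fst l) ls) =
     \<epsilon> * \<beta> * alignment n x ls"
proof -
  have "((1 + \<epsilon> * spin (x v)) * (spin True * imbalance v ls)
        + (1 - \<epsilon> * spin (x v)) * (spin False * imbalance v ls))
      / (2 * real n) = \<epsilon> * \<beta> * (spin (x v) * imbalance v ls)" for v
    using biased_literal_pos by (cases "x v") (simp_all add: \<beta> spin_def field_simps)
  thus ?thesis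
    by (simp only: expectation_biased_literal[OF p] alignment_def sum_distrib_left
        fst_conv snd_conv)
qed

text \<open>Squaring removes the sign and with it the bias. The remaining sum of squared imbalances
  is again expressed by \<open>collision\<close>, so the recursion for the second moment
  closes.\<close>

lemma expectation_increment_square:
  "measure_pmf.expectation p (\<lambda>l. (spin (snd l) * imbalance (fst l) ls)\<^sup>2) =
     (real (length ls) + 2 * collision n ls) * \<beta>"
proof -
  have "((1 + \<epsilon> * spin (x v)) * (spin True * imbalance v ls)\<^sup>2
        + (1 - \<epsilon> * spin (x v)) * (spin False * imbalance v ls)\<^sup>2)
      / (2 * real n) = (imbalance v ls)\<^sup>2 * \<beta>" for v
    using biased_literal_pos by (simp add: \<beta> power_mult_distrib field_simps)
  thus ?thesis
    by (simp only: expectation_biased_literal[OF p] sum_imbalance_square[symmetric] sum_distrib_right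
        fst_conv snd_conv)
qed

lemma expectation_increment_spin:
  "measure_pmf.expectation p
     (\<lambda>l. spin (snd l) * imbalance (fst l) ls * (spin (x (fst l)) * spin (snd l))) =
     alignment n x ls * \<beta>"
proof -
  have "((1 + \<epsilon> * spin (x v)) * (spin True * imbalance v ls * (spin (x v) * spin True))
        + (1 - \<epsilon> * spin (x v)) * (spin False * imbalance v ls * (spin (x v) * spin False)))
      / (2 * real n) = (spin (x v) * imbalance v ls) * \<beta>" for v
    using biased_literal_pos by (cases "x v") (simp_all add: \<beta> spin_def field_simps)
  thus ?thesis
    by (simp only: expectation_biased_literal[OF p] alignment_def sum_distrib_right
        fst_conv snd_conv)
qed

abbreviation Em :: "nat \<Rightarrow> (literal list \<Rightarrow> real) \<Rightarrow> real" where
  "Em m \<equiv> measure_pmf.expectation (replicate_pmf m p)"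

lemma expectation_alignment: "Em m (alignment n x) = real m * \<epsilon>"
proof (induction m)
  case (Suc m)
  have "Em (Suc m) (alignment n x) = Em m (\<lambda>ls. alignment n x ls + \<epsilon>)"
  proof (rule expectation_replicate_pmf_Suc[OF finite_biased_literal])
    fix ls
    have "measure_pmf.expectation p (\<lambda>l. alignment n x (l # ls)) =
        measure_pmf.expectation p (\<lambda>l. alignment n x ls + spin (x (fst l)) * spin (snd l))"
      by (rule expectation_cong_literal) (rule alignment_Cons)
    thus "measure_pmf.expectation p (\<lambda>l. alignment n x (l # ls)) = alignment n x ls + \<epsilon>"
      by (simp add: integrability expectation_spin_alignment)
  qed
  with Suc.IH show ?case by (simp add: integrability algebra_simps)
qed simp

text \<open>The alignment is a sum of \<open>m\<close> independent signs of mean \<epsilon>: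
  \<open>m\<close> diagonal products equal 1, the others have mean \<epsilon>^2.\<close>

lemma expectation_alignment_square:
  "Em m (\<lambda>ls. (alignment n x ls)\<^sup>2) = real m + real m * (real m - 1) * \<epsilon>\<^sup>2"
proof (induction m)
  case (Suc m)
  have "Em (Suc m) (\<lambda>ls. (alignment n x ls)\<^sup>2) =
      Em m (\<lambda>ls. (alignment n x ls)\<^sup>2 + 2 * \<epsilon> * alignment n x ls + 1)"
  proof (rule expectation_replicate_pmf_Suc[OF finite_biased_literal])
    fix ls
    have "measure_pmf.expectation p (\<lambda>l. (alignment n x (l # ls))\<^sup>2) =
        measure_pmf.expectation p (\<lambda>l. (alignment n x ls)\<^sup>2 +
          2 * alignment n x ls * (spin (x (fst l)) * spin (snd l)) + 1)"
      by (rule expectation_cong_literal)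
         (simp add: alignment_Cons power2_sum power_mult_distrib del: atLeastAtMost_iff)
    thus "measure_pmf.expectation p (\<lambda>l. (alignment n x (l # ls))\<^sup>2) =
        (alignment n x ls)\<^sup>2 + 2 * \<epsilon> * alignment n x ls + 1"
      by (simp add: integrability expectation_spin_alignment)
  qed
  with Suc.IH show ?case
    by (simp add: integrability expectation_alignment algebra_simps power2_eq_square)
qed simp

text \<open>Each of the m(m-1)/2 pairs shares its variable with probability \<beta>, and its spins
  then have mean product \<epsilon>^2, since the two factors \<open>spin (x v)\<close>
  cancel.\<close>

lemma expectation_collision:
  "Em m (collision n) = \<epsilon>\<^sup>2 * \<beta> * real m * (real m - 1) / 2"
proof (induction m)
  case (Suc m)
  have "Em (Suc m) (collision n) = Em m (\<lambda>ls. collision n ls + \<epsilon> * \<beta> * alignment n x ls)"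
  proof (rule expectation_replicate_pmf_Suc[OF finite_biased_literal])
    fix ls
    have "measure_pmf.expectation p (\<lambda>l. collision n (l # ls)) =
        measure_pmf.expectation p (\<lambda>l. collision n ls + spin (snd l) * imbalance (fst l) ls)"
      by (rule expectation_cong_literal) (rule collision_Cons)
    thus "measure_pmf.expectation p (\<lambda>l. collision n (l # ls)) =
        collision n ls + \<epsilon> * \<beta> * alignment n x ls"
      by (simp add: integrability expectation_increment)
  qed
  with Suc.IH show ?case
    by (simp add: integrability expectation_alignment algebra_simps power2_eq_square add_divide_distrib diff_divide_distrib)
qed simp

text \<open>The terms pair a collision with one literal. A literal outside the pair contributes a
  further factor \<epsilon>; one of the two inside cancels a spin and leaves mean
  \<open>\<epsilon> * \<beta>\<close>.\<close>

lemma expectation_collision_alignment: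
  "Em m (\<lambda>ls. collision n ls * alignment n x ls) =
     \<epsilon> * \<beta> *
       (\<epsilon>\<^sup>2 * real m * (real m - 1) * (real m - 2) / 2 + real m * (real m - 1))"
proof (induction m)
  case (Suc m)
  let ?U = "collision n" and ?G = "alignment n x"
  have "Em (Suc m) (\<lambda>ls. ?U ls * ?G ls) =
      Em m (\<lambda>ls. ?U ls * ?G ls + \<epsilon> * ?U ls + \<epsilon> * \<beta> * (?G ls)\<^sup>2 + \<beta> * ?G ls)"
  proof (rule expectation_replicate_pmf_Suc[OF finite_biased_literal])
    fix ls
    have "measure_pmf.expectation p (\<lambda>l. ?U (l # ls) * ?G (l # ls)) =
        measure_pmf.expectation p (\<lambda>l. ?U ls * ?G ls + ?U ls * (spin (x (fst l)) * spin (snd l))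
          + ?G ls * (spin (snd l) * imbalance (fst l) ls)
          + spin (snd l) * imbalance (fst l) ls * (spin (x (fst l)) * spin (snd l)))"
      by (rule expectation_cong_literal)
         (simp only: alignment_Cons collision_Cons distrib_left distrib_right mult_ac add_ac)
    thus "measure_pmf.expectation p (\<lambda>l. ?U (l # ls) * ?G (l # ls)) =
        ?U ls * ?G ls + \<epsilon> * ?U ls + \<epsilon> * \<beta> * (?G ls)\<^sup>2 + \<beta> * ?G ls"
      by (simp add: integrability expectation_spin_alignment expectation_increment
          expectation_increment_spin power2_eq_square)
  qed
  also have "\<dots> = Em m (\<lambda>ls. ?U ls * ?G ls) + \<epsilon> * Em m ?U
      + \<epsilon> * \<beta> * Em m (\<lambda>ls. (?G ls)\<^sup>2) + \<beta> * Em m ?G"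
    by (simp add: integrability)
  also have "\<dots> = \<epsilon> * \<beta> * (\<epsilon>\<^sup>2 * real (Suc m) * (real (Suc m) - 1) * (real (Suc m) - 2) / 2
      + real (Suc m) * (real (Suc m) - 1))"
    unfolding Suc.IH expectation_alignment expectation_alignment_square expectation_collision of_nat_Suc
    by (simp add: power2_eq_square field_simps)
  finally show ?case .
qed simp

text \<open>The three summands come from two pairs of indices that are disjoint, share exactly one
  index, or coincide.\<close>

lemma expectation_collision_square:
  "Em m (\<lambda>ls. (collision n ls)\<^sup>2) =
     \<epsilon> ^ 4 * \<beta>\<^sup>2 * real m * (real m - 1) * (real m - 2) * (real m - 3) / 4
     + \<epsilon>\<^sup>2 * \<beta>\<^sup>2 * real m * (real m - 1) * (real m - 2)
     + \<beta> * real m * (real m - 1) / 2"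
proof (induction m)
  case (Suc m)
  let ?U = "collision n" and ?G = "alignment n x"
  have "Em (Suc m) (\<lambda>ls. (?U ls)\<^sup>2) =
      Em m (\<lambda>ls. (?U ls)\<^sup>2 + 2 * \<epsilon> * \<beta> * (?U ls * ?G ls) + 2 * \<beta> * ?U ls + \<beta> * real m)"
  proof (rule expectation_replicate_pmf_Suc[OF finite_biased_literal])
    \<comment> \<open>The length of the tail enters through
      \<open>expectation_increment_square\<close>.\<close>
    fix ls :: "literal list" assume len: "length ls = m"
    have "measure_pmf.expectation p (\<lambda>l. (?U (l # ls))\<^sup>2) =
        measure_pmf.expectation p (\<lambda>l. (?U ls)\<^sup>2 + 2 * ?U ls * (spin (snd l) * imbalance (fst l) ls)
          + (spin (snd l) * imbalance (fst l) ls)\<^sup>2)"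
      by (rule expectation_cong_literal) (simp add: collision_Cons power2_sum del: atLeastAtMost_iff)
    thus "measure_pmf.expectation p (\<lambda>l. (?U (l # ls))\<^sup>2) =
        (?U ls)\<^sup>2 + 2 * \<epsilon> * \<beta> * (?U ls * ?G ls) + 2 * \<beta> * ?U ls + \<beta> * real m"
      by (simp add: integrability expectation_increment expectation_increment_square len)
         (simp add: algebra_simps)
  qed
  also have "\<dots> = Em m (\<lambda>ls. (?U ls)\<^sup>2) + 2 * \<epsilon> * \<beta> * Em m (\<lambda>ls. ?U ls * ?G ls)
      + 2 * \<beta> * Em m ?U + \<beta> * real m"
    by (simp add: integrability)
  also have "\<dots> =
     \<epsilon> ^ 4 * \<beta>\<^sup>2 * real (Suc m) * (real (Suc m) - 1) * (real (Suc m) - 2) * (real (Suc m) - 3) / 4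
     + \<epsilon>\<^sup>2 * \<beta>\<^sup>2 * real (Suc m) * (real (Suc m) - 1) * (real (Suc m) - 2)
     + \<beta> * real (Suc m) * (real (Suc m) - 1) / 2"
    unfolding Suc.IH expectation_collision_alignment expectation_collision of_nat_Suc
    unfolding power2_eq_square power4_eq_xxxx by (simp add: field_simps)
  finally show ?case .
qed simp

text \<open>The contribution of disjoint pairs to the second moment is at most the squared mean, so
  only overlapping pairs remain.\<close>

lemma variance_collision_le:
  "measure_pmf.variance (replicate_pmf m p) (collision n) \<le>
     \<epsilon>\<^sup>2 * \<beta>\<^sup>2 * real m * (real m - 1) * (real m - 2) + \<beta> * real m * (real m - 1) / 2"
proof -
  \<comment> \<open>The last factor is negative for \<open>m \<le> 1\<close>, but there the product
    vanishes.\<close>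
  have "0 \<le> real m * (real m - 1) * (4 * real m - 6)"
  proof (cases "m \<le> 1")
    case True
    hence "m = 0 \<or> m = 1" by auto
    thus ?thesis by auto
  qed auto
  hence "0 \<le> \<epsilon> ^ 4 * \<beta>\<^sup>2 * (real m * (real m - 1) * (4 * real m - 6))"
    by simp
  moreover have "\<epsilon> ^ 4 * \<beta>\<^sup>2 * real m * (real m - 1) * (real m - 2) * (real m - 3) / 4
      - (\<epsilon>\<^sup>2 * \<beta> * real m * (real m - 1) / 2)\<^sup>2 =
      - (\<epsilon> ^ 4 * \<beta>\<^sup>2 * (real m * (real m - 1) * (4 * real m - 6))) / 4"
    unfolding power2_eq_square power4_eq_xxxx by (simp add: algebra_simps add_divide_distrib diff_divide_distrib)
  moreover have "measure_pmf.variance (replicate_pmf m p) (collision n) =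
      Em m (\<lambda>ls. (collision n ls)\<^sup>2) - (Em m (collision n))\<^sup>2"
    by (rule measure_pmf.variance_eq) (rule integrable_literals)+
  ultimately show ?thesis
    unfolding expectation_collision_square expectation_collision by linarith
qed

lemma prob_collision_deviation:
  assumes "a > 0"
  shows "measure_pmf.prob (replicate_pmf m p)
      {ls. a \<le> \<bar>collision n ls - \<epsilon>\<^sup>2 * \<beta> * real m * (real m - 1) / 2\<bar>} \<le>
     (\<epsilon>\<^sup>2 * \<beta>\<^sup>2 * real m * (real m - 1) * (real m - 2) + \<beta> * real m * (real m - 1) / 2) / a\<^sup>2"
proof -
  have "measure_pmf.prob (replicate_pmf m p)
      {ls. a \<le> \<bar>collision n ls - \<epsilon>\<^sup>2 * \<beta> * real m * (real m - 1) / 2\<bar>}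
      \<le> measure_pmf.variance (replicate_pmf m p) (collision n) / a\<^sup>2"
    using measure_pmf.Chebyshev_inequality[of "collision n" "replicate_pmf m p" a] assms
    by (simp add: integrability expectation_collision)
  also have "\<dots> \<le> (\<epsilon>\<^sup>2 * \<beta>\<^sup>2 * real m * (real m - 1) * (real m - 2)
      + \<beta> * real m * (real m - 1) / 2) / a\<^sup>2"
    by (intro divide_right_mono variance_collision_le) simp
  finally show ?thesis .
qed

end

subsection \<open>The law of the first literal\<close>

definition random_clause :: "literal set set \<Rightarrow> literal list pmf" where
  "random_clause C = bind_pmf (pmf_of_set C) (\<lambda>c. pmf_of_set (permutations_of_set c))"

lemma random_formula_eq: "random_formula C m = replicate_pmf m (random_clause C)"
  by (simp add: random_formula_def random_clause_def)

lemma map_replicate_pmf: "map_pmf (map f) (replicate_pmf m p) = replicate_pmf m (map_pmf f p)"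
proof (induction m)
  case (Suc m)
  show ?case
    unfolding replicate_pmf.simps Suc.IH[symmetric]
    by (simp add: map_pmf_def bind_assoc_pmf bind_return_pmf)
qed simp

lemma map_hd_random_permutation:
  assumes "finite A" "A \<noteq> {}"
  shows "map_pmf hd (pmf_of_set (permutations_of_set A)) = pmf_of_set A"
  by (simp add: random_permutation_of_set[OF assms] map_bind_pmf bind_return_pmf')

lemma finite_clause: "c \<in> clauses k n \<Longrightarrow> finite c"
  using finite_subset[of c "{1..n} \<times> (UNIV :: bool set)"] by (simp add: clauses_def)

text \<open>In a random order each of the \<open>k\<close> literals of a clause is equally likely to
  come first. The law of the first literal thus reduces to counting clauses.\<close>

lemma pmf_hd_random_clause:
  assumes C: "C \<subseteq> clauses k n" "C \<noteq> {}" and k: "k \<ge> 1"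
  shows "pmf (map_pmf hd (random_clause C)) l = real (card {c \<in> C. l \<in> c}) / (real k * real (card C))"
proof -
  have fin: "finite C" using C finite_clauses finite_subset by blast
  have c: "finite c" "c \<noteq> {}" "card c = k" if "c \<in> C" for c
    using that C k finite_clause[of c k n] by (auto simp: clauses_def)
  have "map_pmf hd (random_clause C) = bind_pmf (pmf_of_set C) pmf_of_set"
    unfolding random_clause_def map_bind_pmf using C fin c
    by (intro bind_pmf_cong refl) (simp add: map_hd_random_permutation)
  hence "pmf (map_pmf hd (random_clause C)) l = (\<Sum>c\<in>C. pmf (pmf_of_set c) l) / real (card C)"
    using C fin by (simp add: pmf_bind_pmf_of_set)
  also have "(\<Sum>c\<in>C. pmf (pmf_of_set c) l) = (\<Sum>c\<in>C. (if l \<in> c then 1 / real k else 0))"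
    by (intro sum.cong refl) (simp add: c indicator_def)
  also have "\<dots> = real (card {c \<in> C. l \<in> c}) / real k"
    using fin by (simp add: sum.If_cases Int_def)
  finally show ?thesis by (simp add: field_simps)
qed

text \<open>Double counting of incidences. Once symmetry shows the counts to be equal, this total
  determines them.\<close>

lemma sum_card_containing:
  assumes "C \<subseteq> clauses k n"
  shows "(\<Sum>l\<in>{1..n} \<times> UNIV. card {c \<in> C. l \<in> c}) = k * card C"
proof -
  have fin: "finite C" using assms finite_clauses finite_subset by blast
  have "(\<Sum>l\<in>{1..n} \<times> UNIV. card {c \<in> C. l \<in> c}) =
      (\<Sum>l\<in>{1..n} \<times> UNIV. \<Sum>c\<in>C. if l \<in> c then 1 else 0)"
    using fin by (simp add: sum.If_cases Int_def)
  also have "\<dots> = (\<Sum>c\<in>C. \<Sum>l\<in>{1..n} \<times> UNIV. if l \<in> c then 1 else 0)"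
    by (rule sum.swap)
  also have "\<dots> = (\<Sum>c\<in>C. k)"
  proof (rule sum.cong[OF refl])
    fix c assume "c \<in> C"
    hence c: "c \<subseteq> {1..n} \<times> UNIV" "card c = k" using assms by (auto simp: clauses_def)
    have "(\<Sum>l\<in>{1..n} \<times> UNIV. if l \<in> c then 1 else 0) = card (({1..n} \<times> (UNIV :: bool set)) \<inter> c)"
      by (simp add: sum.If_cases Int_def)
    also have "({1..n} \<times> UNIV) \<inter> c = c" using c by blast
    finally show "(\<Sum>l\<in>{1..n} \<times> UNIV. if l \<in> c then 1 else 0) = k" using c by simp
  qed
  finally show ?thesis by simp
qed

section \<open>Symmetries of the clause set\<close>

lemma card_containing_involution:
  fixes h :: "'a \<Rightarrow> 'a"
  assumes h: "\<And>l. h (h l) = l" and C: "\<And>c. c \<in> C \<Longrightarrow> h ` c \<in> C"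
  shows "card {c \<in> C. h l \<in> c} = card {c \<in> C. l \<in> c}"
proof -
  have hh: "h ` h ` c = c" for c by (simp add: image_image h)
  have "bij_betw ((`) h) {c \<in> C. h l \<in> c} {c \<in> C. l \<in> c}"
    by (rule bij_betw_byWitness[where f' = "(`) h"]) (auto simp: hh C, metis h imageI)
  thus ?thesis by (rule bij_betw_same_card)
qed

text \<open>Exchanges two variables and negates the literals whose variable is marked by \<tau>. A
  constant \<tau> carries a literal to any other; a \<tau> depending on \<open>x\<close> preserves
  satisfaction by \<open>x\<close>.\<close>

definition swap_literal :: "nat \<Rightarrow> nat \<Rightarrow> (nat \<Rightarrow> bool) \<Rightarrow> literal \<Rightarrow> literal" where
  "swap_literal v w \<tau> l = (Transposition.transpose v w (fst l), snd l \<noteq> \<tau> (fst l))"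

text \<open>Invariance of \<tau> under the transposition makes the map an involution, so sizes are
  kept; variables stay distinct because the transposition is injective.\<close>

lemma swap_literal_clauses:
  assumes vw: "v \<in> {1..n}" "w \<in> {1..n}" and \<tau>: "\<And>u. \<tau> (Transposition.transpose v w u) = \<tau> u"
    and c: "c \<in> clauses k n"
  shows "swap_literal v w \<tau> ` c \<in> clauses k n"
proof -
  let ?h = "swap_literal v w \<tau>"
  have "?h (?h l) = l" for l by (auto simp: swap_literal_def \<tau> prod_eq_iff)
  hence "inj ?h" by (metis injI)
  hence "card (?h ` c) = card c" by (metis card_image inj_on_subset subset_UNIV)
  moreover have "inj_on fst (?h ` c)"
  proof (rule inj_onI)
    fix a a' assume "a \<in> ?h ` c" "a' \<in> ?h ` c" and eq: "fst a = fst a'"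
    then obtain l l' where l: "l \<in> c" "l' \<in> c" "a = ?h l" "a' = ?h l'" by blast
    with eq have "Transposition.transpose v w (fst l) = Transposition.transpose v w (fst l')"
      by (simp add: swap_literal_def)
    hence "fst l = fst l'" by (rule injD[OF inj_transpose])
    moreover have "inj_on fst c" using c by (simp add: clauses_def)
    ultimately have "l = l'" using l by (metis inj_onD)
    with l show "a = a'" by simp
  qed
  moreover have "?h ` c \<subseteq> {1..n} \<times> UNIV"
  proof
    fix a assume "a \<in> ?h ` c"
    then obtain l where "l \<in> c" "a = ?h l" by blast
    moreover from this c have "fst l \<in> {1..n}" by (auto simp: clauses_def)
    ultimately show "a \<in> {1..n} \<times> UNIV"
      using vw by (simp add: swap_literal_def Transposition.transpose_def)
  qed
  ultimately show ?thesis using c by (simp add: clauses_def)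
qed

(* The sign flips exactly when x distinguishes the two variables, so agreement with x is kept. *)
lemma clause_sat_swap:
  "clause_sat x (swap_literal v w (\<lambda>u. x u \<noteq> x (Transposition.transpose v w u)) ` c) \<longleftrightarrow>
     clause_sat x c"
proof -
  have "x (fst (swap_literal v w (\<lambda>u. x u \<noteq> x (Transposition.transpose v w u)) l)) =
      snd (swap_literal v w (\<lambda>u. x u \<noteq> x (Transposition.transpose v w u)) l) \<longleftrightarrow> x (fst l) = snd l" for l
    unfolding swap_literal_def fst_conv snd_conv by argo
  thus ?thesis by (simp add: clause_sat_def split_beta)
qed

lemma card_clauses_containing:
  assumes v: "v \<in> {1..n}"
  shows "2 * n * card {c \<in> clauses k n. (v, b) \<in> c} = k * 2 ^ k * (n choose k)"
proof -
  have "card {c \<in> clauses k n. l \<in> c} = card {c \<in> clauses k n. (v, b) \<in> c}"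
    if l: "l \<in> {1..n} \<times> UNIV" for l
  proof -
    \<comment> \<open>The sign is flipped exactly when \<open>b\<close> differs from that of
      \<open>l\<close>, so that \<open>(v, b)\<close> is sent to \<open>l\<close>.\<close>
    let ?h = "swap_literal v (fst l) (\<lambda>_. b \<noteq> snd l)"
    have "card {c \<in> clauses k n. ?h (v, b) \<in> c} = card {c \<in> clauses k n. (v, b) \<in> c}"
      using v l by (intro card_containing_involution swap_literal_clauses)
        (auto simp: swap_literal_def prod_eq_iff)
    moreover have "?h (v, b) = l" by (auto simp: swap_literal_def prod_eq_iff)
    ultimately show ?thesis by simp
  qed
  hence "(\<Sum>l\<in>{1..n} \<times> (UNIV :: bool set). card {c \<in> clauses k n. l \<in> c}) =
      (\<Sum>l\<in>{1..n} \<times> (UNIV :: bool set). card {c \<in> clauses k n. (v, b) \<in> c})"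
    by (intro sum.cong) auto
  also have "\<dots> = 2 * n * card {c \<in> clauses k n. (v, b) \<in> c}"
    by simp
  finally show ?thesis
    unfolding sum_card_containing[OF subset_refl] card_clauses by (simp only: mult.assoc)
qed

definition violated_clauses :: "nat \<Rightarrow> nat \<Rightarrow> (nat \<Rightarrow> bool) \<Rightarrow> literal set set" where
  "violated_clauses k n x = {c \<in> clauses k n. \<not> clause_sat x c}"

lemma card_violated_clauses: "card (violated_clauses k n x) = n choose k"
proof -
  have "card (clauses k n - satisfied_clauses k n x) = card (clauses k n) - card (satisfied_clauses k n x)"
    by (intro card_Diff_subset finite_subset[OF _ finite_clauses]) (auto simp: satisfied_clauses_def)
  also have "\<dots> = n choose k"
    by (simp add: card_clauses card_satisfied_clauses diff_mult_distrib)
  also have "clauses k n - satisfied_clauses k n x = violated_clauses k n x"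
    by (auto simp: satisfied_clauses_def violated_clauses_def)
  finally show ?thesis .
qed

lemma violated_clauses_containing_true: "{c \<in> violated_clauses k n x. (v, x v) \<in> c} = {}"
  by (auto simp: violated_clauses_def clause_sat_def)

text \<open>A violated clause consists of false literals only. By symmetry the \<open>n\<close>
  false literals share the incidences equally.\<close>

lemma card_violated_clauses_containing:
  assumes v: "v \<in> {1..n}"
  shows "n * card {c \<in> violated_clauses k n x. (v, \<not> x v) \<in> c} = k * (n choose k)"
proof -
  let ?C = "violated_clauses k n x"
  have eq: "card {c \<in> ?C. (w, \<not> x w) \<in> c} = card {c \<in> ?C. (v, \<not> x v) \<in> c}"
    if w: "w \<in> {1..n}" for w
  proof -
    let ?h = "swap_literal v w (\<lambda>u. x u \<noteq> x (Transposition.transpose v w u))"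
    have "card {c \<in> ?C. ?h (v, \<not> x v) \<in> c} = card {c \<in> ?C. (v, \<not> x v) \<in> c}"
    proof (rule card_containing_involution)
      show "?h (?h l) = l" for l by (auto simp: swap_literal_def prod_eq_iff)
      fix c assume "c \<in> ?C"
      moreover from this have "?h ` c \<in> clauses k n"
        using v w by (intro swap_literal_clauses) (auto simp: violated_clauses_def)
      ultimately show "?h ` c \<in> ?C"
        unfolding violated_clauses_def mem_Collect_eq clause_sat_swap by blast
    qed
    moreover have "?h (v, \<not> x v) = (w, \<not> x w)"
      by (cases "x v"; cases "x w") (simp_all add: swap_literal_def)
    ultimately show ?thesis by simp
  qed
  have "k * (n choose k) = (\<Sum>l\<in>{1..n} \<times> UNIV. card {c \<in> ?C. l \<in> c})"
    by (subst sum_card_containing[of _ k n])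
       (auto simp: violated_clauses_def card_violated_clauses[unfolded violated_clauses_def])
  also have "\<dots> = (\<Sum>w\<in>{1..n}. \<Sum>b\<in>UNIV. card {c \<in> ?C. (w, b) \<in> c})"
    by (simp add: sum.cartesian_product)
  also have "\<dots> = (\<Sum>w\<in>{1..n}. card {c \<in> ?C. (v, \<not> x v) \<in> c})"
  proof (rule sum.cong[OF refl])
    fix w assume w: "w \<in> {1..n}"
    have "(\<Sum>b\<in>UNIV. card {c \<in> ?C. (w, b) \<in> c}) =
        card {c \<in> ?C. (w, x w) \<in> c} + card {c \<in> ?C. (w, \<not> x w) \<in> c}"
      by (cases "x w") (simp_all add: UNIV_bool)
    thus "(\<Sum>b\<in>UNIV. card {c \<in> ?C. (w, b) \<in> c}) = card {c \<in> ?C. (v, \<not> x v) \<in> c}"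
      by (simp add: violated_clauses_containing_true eq[OF w])
  qed
  finally show ?thesis by simp
qed

lemma set_pmf_hd_random_clause:
  assumes C: "C \<subseteq> clauses k n" "C \<noteq> {}" and k: "k \<ge> 1"
  shows "set_pmf (map_pmf hd (random_clause C)) \<subseteq> {1..n} \<times> UNIV"
proof
  fix l assume "l \<in> set_pmf (map_pmf hd (random_clause C))"
  hence "card {c \<in> C. l \<in> c} \<noteq> 0"
    by (auto simp: pmf_hd_random_clause[OF assms] set_pmf_iff simp del: set_map_pmf)
  hence "{c \<in> C. l \<in> c} \<noteq> {}" by (metis card.empty)
  then obtain c where "c \<in> C" "l \<in> c" by blast
  thus "l \<in> {1..n} \<times> UNIV" using C by (auto simp: clauses_def)
qed

lemma nonempty_clauses: "k \<le> n \<Longrightarrow> clauses k n \<noteq> {}"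
  using card_clauses[of k n] by auto

lemma nonempty_satisfied_clauses: "1 \<le> k \<Longrightarrow> k \<le> n \<Longrightarrow> satisfied_clauses k n x \<noteq> {}"
  using card_satisfied_clauses[of k n x] one_less_power[of "2 :: nat" k] by auto

lemma biased_literal_clauses:
  assumes k: "1 \<le> k" "k \<le> n"
  shows "biased_literal n x 0 (map_pmf hd (random_clause (clauses k n)))"
proof -
  note ne = nonempty_clauses[OF k(2)]
  have "pmf (map_pmf hd (random_clause (clauses k n))) (v, b) = 1 / (2 * real n)"
    if v: "v \<in> {1..n}" for v b
  proof -
    have "2 * real n * real (card {c \<in> clauses k n. (v, b) \<in> c}) = real k * real (card (clauses k n))"
      using arg_cong[OF card_clauses_containing[OF v, of k b], of real] by (simp add: card_clauses)
    moreover have "card (clauses k n) > 0" using ne finite_clauses by (simp add: card_gt_0_iff)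
    ultimately show ?thesis
      unfolding pmf_hd_random_clause[OF subset_refl ne k(1)] using k by (simp add: field_simps)
  qed
  thus ?thesis
    unfolding biased_literal_def
    using set_pmf_hd_random_clause[OF subset_refl ne k(1)] k by simp
qed

text \<open>Count all clauses containing the literal and subtract the violated ones: a true literal
  loses none, a false one loses \<open>k / n\<close> times \<open>n choose k\<close>. Dividing by
  the total turns this gap into the bias \<open>1 / (2 ^ k - 1)\<close>.\<close>

lemma biased_literal_satisfied_clauses:
  assumes k: "1 \<le> k" "k \<le> n"
  shows "biased_literal n x (1 / (2 ^ k - 1)) (map_pmf hd (random_clause (satisfied_clauses k n x)))"
proof -
  let ?S = "satisfied_clauses k n x"
  define q K :: real where "q = 2 ^ k" and "K = real (n choose k)"
  have q: "q > 1" unfolding q_def using k by (intro one_less_power) auto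
  have K: "K > 0" using k by (simp add: K_def)
  have sub: "?S \<subseteq> clauses k n" by (auto simp: satisfied_clauses_def)
  have cardS: "real (card ?S) = (q - 1) * K"
    by (simp add: card_satisfied_clauses q_def K_def of_nat_diff)
  note ne = nonempty_satisfied_clauses[OF k, of x]
  have pmf: "pmf (map_pmf hd (random_clause ?S)) (v, b) =
      (1 + 1 / (q - 1) * spin (x v) * spin b) / (2 * real n)" if v: "v \<in> {1..n}" for v b
  proof -
    let ?N = "{c \<in> clauses k n. (v, b) \<in> c}" and ?M = "{c \<in> violated_clauses k n x. (v, b) \<in> c}"
    have "{c \<in> ?S. (v, b) \<in> c} = ?N - ?M"
      by (auto simp: satisfied_clauses_def violated_clauses_def)
    moreover have "?M \<subseteq> ?N" "finite ?N"
      using finite_clauses by (auto simp: violated_clauses_def)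
    ultimately have card: "real (card {c \<in> ?S. (v, b) \<in> c}) = real (card ?N) - real (card ?M)"
      by (simp add: card_Diff_subset finite_subset of_nat_diff card_mono)
    have N: "real (card ?N) = real k * q * K / (2 * real n)"
      using arg_cong[OF card_clauses_containing[OF v, of k b], of real] k
      by (simp add: q_def K_def field_simps)
    have M: "real (card ?M) = (if b = x v then 0 else real k * K / real n)"
    proof (cases "b = x v")
      case True
      thus ?thesis by (simp only: violated_clauses_containing_true) simp
    next
      case False
      hence b: "b = (\<not> x v)" by auto
      show ?thesis
        using arg_cong[OF card_violated_clauses_containing[OF v, of k x], of real] k
        by (simp add: b K_def field_simps)
    qed
    have "spin (x v) * spin b = (if b = x v then 1 else -1)" by (auto simp: spin_def)
    thus ?thesis
      unfolding pmf_hd_random_clause[OF sub ne k(1)] card N M cardS mult.assoc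
      using k q K by (simp add: divide_simps) (simp add: algebra_simps)
  qed
  show ?thesis
    unfolding biased_literal_def
    using set_pmf_hd_random_clause[OF sub ne k(1)] k pmf by (simp add: q_def)
qed

subsection \<open>The likelihood-ratio test is optimal\<close>

lemma pmf_replicate_pmf:
  "pmf (replicate_pmf m p) xs = (if length xs = m then (\<Prod>x\<leftarrow>xs. pmf p x) else 0)"
proof (induction m arbitrary: xs)
  case 0
  show ?case by (cases xs) auto
next
  case (Suc m)
  have eq: "replicate_pmf (Suc m) p = map_pmf (\<lambda>(x, xs). x # xs) (pair_pmf p (replicate_pmf m p))"
    by (simp add: pair_pmf_def map_bind_pmf bind_return_pmf map_pmf_def bind_assoc_pmf)
  show ?case
  proof (cases xs)
    case Nil
    thus ?thesis by (auto simp: pmf_eq_0_set_pmf set_replicate_pmf simp del: replicate_pmf.simps)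
  next
    case (Cons y ys)
    have "pmf (replicate_pmf (Suc m) p) (y # ys) = pmf (pair_pmf p (replicate_pmf m p)) (y, ys)"
      unfolding eq using pmf_map_inj'[of "\<lambda>(x, xs). x # xs" "pair_pmf p (replicate_pmf m p)" "(y, ys)"]
      by (simp add: inj_on_def split_beta prod_eq_iff)
    thus ?thesis by (simp add: Cons Suc.IH pmf_pair)
  qed
qed

lemma pmf_random_clause:
  assumes C: "C \<subseteq> clauses k n" "C \<noteq> {}" and l: "l \<in> ordered_clauses k n"
  shows "pmf (random_clause C) l = (if set l \<in> C then 1 / (real (card C) * fact k) else 0)"
proof -
  have fin: "finite C" using C finite_clauses finite_subset by blast
  have c: "finite c" "card c = k" if "c \<in> C" for c
    using that C finite_clause[of c k n] by (auto simp: clauses_def)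
  have dist: "distinct l" using l by (auto simp: ordered_clauses_def distinct_map)
  have "pmf (random_clause C) l = (\<Sum>c\<in>C. pmf (pmf_of_set (permutations_of_set c)) l) / real (card C)"
    unfolding random_clause_def using C fin by (simp add: pmf_bind_pmf_of_set)
  also have "(\<Sum>c\<in>C. pmf (pmf_of_set (permutations_of_set c)) l) =
      (\<Sum>c\<in>C. if set l = c then 1 / fact k else 0)"
  proof (intro sum.cong refl)
    fix c' assume "c' \<in> C"
    moreover have "l \<in> permutations_of_set c' \<longleftrightarrow> set l = c'"
      using dist by (auto simp: permutations_of_set_def)
    ultimately show "pmf (pmf_of_set (permutations_of_set c')) l = (if set l = c' then 1 / fact k else 0)"
      by (simp add: c)
  qed
  also have "\<dots> = (if set l \<in> C then 1 / fact k else 0)" using fin by simp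
  finally show ?thesis by simp
qed

text \<open>The law is constant on its support, since every clause has the same number of orders.
  This is why the likelihood ratio depends on the formula only through
  \<open>num_sat\<close>.\<close>

lemma pmf_random_formula:
  assumes C: "C \<subseteq> clauses k n" "C \<noteq> {}" and \<phi>: "\<phi> \<in> formulas k n m"
  shows "pmf (random_formula C m) \<phi> =
    (if \<forall>l\<in>set \<phi>. set l \<in> C then (1 / (real (card C) * fact k)) ^ m else 0)"
proof -
  have "(\<Prod>l\<leftarrow>\<phi>. pmf (random_clause C) l) =
      (if \<forall>l\<in>set \<phi>. set l \<in> C then (1 / (real (card C) * fact k)) ^ length \<phi> else 0)"
    if "set \<phi> \<subseteq> ordered_clauses k n"
    using that by (induction \<phi>) (auto simp: pmf_random_clause[OF C])
  thus ?thesis using \<phi> by (simp add: random_formula_eq pmf_replicate_pmf formulas_def)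
qed

lemma set_ordered_clause: "l \<in> ordered_clauses k n \<Longrightarrow> set l \<in> clauses k n"
  by (auto simp: clauses_def ordered_clauses_def distinct_map distinct_card)

lemma finite_formulas: "finite (formulas k n m)"
proof -
  have "finite (ordered_clauses k n)"
    by (rule finite_subset[OF _ finite_lists_length_eq[of "{1..n} \<times> (UNIV :: bool set)" k]])
       (auto simp: ordered_clauses_def)
  from finite_lists_length_eq[OF this, of m] show ?thesis
    by (simp add: formulas_def conj_commute)
qed

text \<open>The factor of \<open>num_sat\<close> in the planted density relative to the uniform one;
  by \<open>expectation_num_sat\<close> it is the reciprocal of the expected number of
  solutions.\<close>

definition density_ratio :: "nat \<Rightarrow> nat \<Rightarrow> nat \<Rightarrow> real" where
  "density_ratio k n m = (2 ^ k / (2 ^ k - 1)) ^ m / 2 ^ n"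

lemma density_ratio_pos: "k \<ge> 1 \<Longrightarrow> density_ratio k n m > 0"
  using one_less_power[of "2 :: real" k] by (simp add: density_ratio_def)

lemma pmf_P_planted:
  assumes k: "1 \<le> k" "k \<le> n" and \<phi>: "\<phi> \<in> formulas k n m"
  shows "pmf (P_planted k n m) \<phi> = density_ratio k n m * real (num_sat n \<phi>) * pmf (P_unif k n m) \<phi>"
proof -
  \<comment> \<open>There are \<open>q * D\<close> ordered clauses, of which
    \<open>(q - 1) * D\<close> are satisfied by a given assignment.\<close>
  define q D :: real where "q = 2 ^ k" and "D = real (n choose k) * fact k"
  have q: "q > 1" unfolding q_def using k by (intro one_less_power) auto
  have D: "D > 0" using k by (simp add: D_def)
  have cl: "set l \<in> clauses k n" if "l \<in> set \<phi>" for l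
    using that \<phi> by (auto simp: formulas_def intro: set_ordered_clause)
  have unif: "pmf (P_unif k n m) \<phi> = (1 / (q * D)) ^ m"
    unfolding P_unif_def using k \<phi> cl
    by (subst pmf_random_formula[of _ k n]) (auto simp: nonempty_clauses card_clauses q_def D_def mult_ac)
  have P_at: "pmf (P_at k n m x) \<phi> =
      (if \<forall>l\<in>set \<phi>. clause_sat x (set l) then (1 / ((q - 1) * D)) ^ m else 0)" for x
  proof -
    have "real (card (satisfied_clauses k n x)) * fact k = (q - 1) * D"
      by (simp add: card_satisfied_clauses q_def D_def of_nat_diff)
    moreover have "(\<forall>l\<in>set \<phi>. set l \<in> satisfied_clauses k n x) \<longleftrightarrow> (\<forall>l\<in>set \<phi>. clause_sat x (set l))"
      using cl by (auto simp: satisfied_clauses_def)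
    moreover have "satisfied_clauses k n x \<subseteq> clauses k n" by (auto simp: satisfied_clauses_def)
    ultimately show ?thesis
      unfolding P_at_def using nonempty_satisfied_clauses[OF k, of x] \<phi>
      by (subst pmf_random_formula[of _ k n]) auto
  qed
  have ne: "assignments n \<noteq> {}" using card_assignments[of n] by auto
  have "pmf (P_planted k n m) \<phi> = (\<Sum>x\<in>assignments n. pmf (P_at k n m x) \<phi>) / 2 ^ n"
    unfolding P_planted_def using ne
    by (simp add: pmf_bind_pmf_of_set finite_assignments card_assignments)
  also have "(\<Sum>x\<in>assignments n. pmf (P_at k n m x) \<phi>) = real (num_sat n \<phi>) * (1 / ((q - 1) * D)) ^ m"
    by (simp add: P_at num_sat_def sat_assignments_def sum.If_cases finite_assignments Int_def)
  also have "(1 / ((q - 1) * D)) ^ m = (q / (q - 1)) ^ m * (1 / (q * D)) ^ m"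
    using q D by (simp add: power_mult_distrib[symmetric])
  finally show ?thesis by (simp add: unif density_ratio_def q_def)
qed

text \<open>The planted density sums to 1. Hence \<open>num_sat\<close> crosses its uniform mean
  exactly where the likelihood ratio crosses 1.\<close>

lemma expectation_num_sat:
  assumes k: "1 \<le> k" "k \<le> n"
  shows "density_ratio k n m * measure_pmf.expectation (P_unif k n m) (\<lambda>\<psi>. real (num_sat n \<psi>)) = 1"
proof -
  have "measure_pmf.expectation (P_unif k n m) (\<lambda>\<psi>. real (num_sat n \<psi>)) =
      (\<Sum>\<phi>\<in>formulas k n m. real (num_sat n \<phi>) * pmf (P_unif k n m) \<phi>)"
    using set_pmf_P_unif[OF k(2), of m] by (intro integral_measure_pmf_real finite_formulas) simp
  hence "density_ratio k n m * measure_pmf.expectation (P_unif k n m) (\<lambda>\<psi>. real (num_sat n \<psi>)) =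
      (\<Sum>\<phi>\<in>formulas k n m. pmf (P_planted k n m) \<phi>)"
    by (simp add: sum_distrib_left pmf_P_planted[OF k] mult.assoc)
  also have "\<dots> = 1"
    using set_pmf_P_planted[OF k] by (intro sum_pmf_eq_1 finite_formulas)
  finally show ?thesis .
qed

text \<open>At each formula a test is charged either the uniform or the planted mass, and the
  likelihood-ratio test always incurs the smaller one.\<close>

lemma neyman_pearson:
  assumes k: "1 \<le> k" "k \<le> n"
  shows "measure_pmf.prob (P_unif k n m) {\<phi> \<in> formulas k n m. Psi_LR k n m \<phi> = 1}
      + measure_pmf.prob (P_planted k n m) {\<phi> \<in> formulas k n m. Psi_LR k n m \<phi> = 0}
    \<le> measure_pmf.prob (P_unif k n m) {\<phi> \<in> formulas k n m. R \<phi>}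
      + measure_pmf.prob (P_planted k n m) {\<phi> \<in> formulas k n m. \<not> R \<phi>}"
proof -
  let ?F = "formulas k n m" and ?P = "pmf (P_unif k n m)" and ?Q = "pmf (P_planted k n m)"
  let ?r = "density_ratio k n m"
  let ?E = "measure_pmf.expectation (P_unif k n m) (\<lambda>\<psi>. real (num_sat n \<psi>))"
  have prob: "measure_pmf.prob M {\<phi> \<in> ?F. S \<phi>} = (\<Sum>\<phi>\<in>?F. if S \<phi> then pmf M \<phi> else 0)" for M S
    using finite_formulas[of k n m] by (simp add: measure_measure_pmf_finite sum.If_cases Int_def)
  have "(if Psi_LR k n m \<phi> = 1 then ?P \<phi> else 0) + (if Psi_LR k n m \<phi> = 0 then ?Q \<phi> else 0)
      \<le> (if R \<phi> then ?P \<phi> else 0) + (if \<not> R \<phi> then ?Q \<phi> else 0)" if \<phi>: "\<phi> \<in> ?F" for \<phi>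
  proof -
    have Q: "?Q \<phi> = ?r * real (num_sat n \<phi>) * ?P \<phi>" by (rule pmf_P_planted[OF k \<phi>])
    show ?thesis
    proof (cases "real (num_sat n \<phi>) > ?E")
      case True
      hence "?r * real (num_sat n \<phi>) \<ge> 1"
        using density_ratio_pos[OF k(1)] expectation_num_sat[OF k, of m]
        by (metis less_imp_le mult_left_mono)
      hence "?P \<phi> \<le> ?Q \<phi>" unfolding Q using mult_right_mono[of 1 _ "?P \<phi>"] by simp
      thus ?thesis using True by (simp add: Psi_LR_def)
    next
      case False
      hence "?r * real (num_sat n \<phi>) \<le> 1"
        using density_ratio_pos[OF k(1)] expectation_num_sat[OF k, of m]
        by (metis less_imp_le mult_left_mono not_le)
      hence "?Q \<phi> \<le> ?P \<phi>" unfolding Q using mult_right_mono[of _ 1 "?P \<phi>"] by simp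
      thus ?thesis using False by (simp add: Psi_LR_def)
    qed
  qed
  thus ?thesis unfolding prob sum.distrib[symmetric] by (rule sum_mono)
qed

subsection \<open>Comparison with the collision test\<close>

lemma prob_bind_pmf_le:
  assumes "\<And>x. measure_pmf.prob (f x) A \<le> c" and "c \<ge> 0"
  shows "measure_pmf.prob (bind_pmf M f) A \<le> c"
proof -
  have "emeasure (measure_pmf (bind_pmf M f)) A = (\<integral>\<^sup>+x. emeasure (measure_pmf (f x)) A \<partial>measure_pmf M)"
    by simp
  also have "\<dots> \<le> (\<integral>\<^sup>+x. ennreal c \<partial>measure_pmf M)"
    by (intro nn_integral_mono) (simp add: measure_pmf.emeasure_eq_measure assms ennreal_leI)
  also have "\<dots> = ennreal c"
    by simp
  finally show ?thesis using assms(2) by (simp add: measure_pmf.emeasure_eq_measure)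
qed

text \<open>Passes to the first literals, which are again independent, so that the moment bounds
  apply.\<close>

lemma prob_random_formula_le:
  assumes "\<And>\<phi>. \<phi> \<in> A \<Longrightarrow> map hd \<phi> \<in> B"
  shows "measure_pmf.prob (random_formula C m) A \<le>
           measure_pmf.prob (replicate_pmf m (map_pmf hd (random_clause C))) B"
proof -
  have "measure_pmf.prob (random_formula C m) A \<le>
      measure_pmf.prob (random_formula C m) (map hd -` B)"
    using assms by (intro measure_pmf.finite_measure_mono) auto
  also have "\<dots> = measure_pmf.prob (map_pmf (map hd) (random_formula C m)) B"
    by simp
  finally show ?thesis by (simp only: random_formula_eq map_replicate_pmf)
qed

text \<open>Here \<open>e\<close> stands for \<epsilon>^2 and \<open>a\<close> for half the planted
  mean. The two pair terms add up to 16 n / (e^2 M) and the term with one shared index is 16 (m - 2)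
  / (e M); the lower bounds on \<open>m\<close> make each at most \<open>\<delta> / 2\<close>, using
  \<open>M \<ge> m^2 / 2\<close> for the first.\<close>

lemma chebyshev_bounds_le:
  fixes n m e \<delta> :: real
  assumes n: "n > 0" and e: "e > 0" and \<delta>: "\<delta> > 0" and m: "m \<ge> 2"
    and m1: "m\<^sup>2 \<ge> 64 * n / (e\<^sup>2 * \<delta>)" and m2: "m \<ge> 32 / (e * \<delta>)"
  defines "a \<equiv> e * (1 / n) * m * (m - 1) / 4"
  shows "(1 / n * m * (m - 1) / 2) / a\<^sup>2
    + (e * (1 / n)\<^sup>2 * m * (m - 1) * (m - 2) + 1 / n * m * (m - 1) / 2) / a\<^sup>2 \<le> \<delta>"
proof -
  define M where "M = m * (m - 1)"
  have M: "M > 0" using m by (simp add: M_def)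
  have a: "a = e * M / (4 * n)" by (simp add: a_def M_def)
  have "(1 / n * m * (m - 1) / 2) / a\<^sup>2
      + (e * (1 / n)\<^sup>2 * m * (m - 1) * (m - 2) + 1 / n * m * (m - 1) / 2) / a\<^sup>2
    = (M / (2 * n)) / a\<^sup>2 + (e * (1 / n)\<^sup>2 * M * (m - 2) + M / (2 * n)) / a\<^sup>2"
    by (simp add: M_def mult_ac)
  also have "\<dots> = 16 * n / (e\<^sup>2 * M) + 16 * (m - 2) / (e * M)"
    unfolding a using n e M by (simp add: power2_eq_square divide_simps) (simp add: algebra_simps)
  also have "\<dots> \<le> \<delta> / 2 + \<delta> / 2"
  proof (rule add_mono)
    have "m * 2 \<le> m * m" using m by (intro mult_left_mono) auto
    hence "m\<^sup>2 / 2 \<le> M" by (simp add: M_def power2_eq_square algebra_simps)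
    hence "16 * n / (e\<^sup>2 * M) \<le> 16 * n / (e\<^sup>2 * (m\<^sup>2 / 2))"
      using n e m M by (intro divide_left_mono mult_left_mono) auto
    also have "\<dots> \<le> \<delta> / 2"
      using m1 n e m \<delta> by (simp add: divide_simps algebra_simps)
    finally show "16 * n / (e\<^sup>2 * M) \<le> \<delta> / 2" .
    have "16 * (m - 2) / (e * M) \<le> 16 * (m - 1) / (e * M)"
      using e M by (intro divide_right_mono) auto
    also have "\<dots> = 16 / (e * m)"
      using e m by (simp add: M_def divide_simps)
    also have "\<dots> \<le> \<delta> / 2"
      using m2 e m \<delta> by (simp add: divide_simps) (simp add: algebra_simps)
    finally show "16 * (m - 2) / (e * M) \<le> \<delta> / 2" .
  qed
  finally show ?thesis by simp
qed

theorem theorem2p1: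
  fixes k :: nat and \<delta> :: real
  assumes "k \<ge> 2" and "0 < \<delta>" and "\<delta> < 1"
  shows "\<exists>C>0. \<exists>N. \<forall>n\<ge>N. \<forall>m\<ge>N. real m \<ge> C * sqrt (real n) \<longrightarrow>
           max (measure_pmf.prob (P_unif k n m) {\<phi> \<in> formulas k n m. Psi_LR k n m \<phi> = 1})
               (measure_pmf.prob (P_planted k n m) {\<phi> \<in> formulas k n m. Psi_LR k n m \<phi> = 0})
             \<le> \<delta>"
proof -
  define \<epsilon> :: real where "\<epsilon> = 1 / (2 ^ k - 1)"
  have "(2 :: real) ^ k > 1" using assms(1) by (intro one_less_power) auto
  hence \<epsilon>: "\<epsilon> > 0" by (simp add: \<epsilon>_def)
  \<comment> \<open>Squaring \<open>m \<ge> C * sqrt n\<close> gives the quadratic hypothesis of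
    \<open>chebyshev_bounds_le\<close>; \<open>N\<close> supplies its linear one, as well as
    \<open>k \<le> n\<close> and \<open>m \<ge> 2\<close>.\<close>
  define C where "C = 8 / (\<epsilon>\<^sup>2 * sqrt \<delta>)"
  define N where "N = max k (nat \<lceil>32 / (\<epsilon>\<^sup>2 * \<delta>)\<rceil>)"
  have "max (measure_pmf.prob (P_unif k n m) {\<phi> \<in> formulas k n m. Psi_LR k n m \<phi> = 1})
            (measure_pmf.prob (P_planted k n m) {\<phi> \<in> formulas k n m. Psi_LR k n m \<phi> = 0}) \<le> \<delta>"
    if n: "n \<ge> N" and m: "m \<ge> N" and mn: "real m \<ge> C * sqrt (real n)" for n m
  proof -
    have k: "1 \<le> k" "k \<le> n" using assms(1) n by (auto simp: N_def)
    have n0: "real n > 0" using k by simp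
    have m2: "real m \<ge> 2" using assms(1) m by (simp add: N_def)
    define a where "a = \<epsilon>\<^sup>2 * (1 / real n) * real m * (real m - 1) / 4"
    have a: "a > 0" using \<epsilon> n0 m2 by (simp add: a_def)
    have mean: "\<epsilon>\<^sup>2 * (1 / real n) * real m * (real m - 1) / 2 = 2 * a"
      by (simp add: a_def mult_ac)
    let ?R = "\<lambda>\<phi>. collision n (map hd \<phi>) \<ge> a"
    let ?vU = "1 / real n * real m * (real m - 1) / 2"
    let ?vP = "\<epsilon>\<^sup>2 * (1 / real n)\<^sup>2 * real m * (real m - 1) * (real m - 2) + 1 / real n * real m * (real m - 1) / 2"
    have unif: "measure_pmf.prob (P_unif k n m) {\<phi> \<in> formulas k n m. ?R \<phi>} \<le> ?vU / a\<^sup>2"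
    proof -
      \<comment> \<open>The zero mean is spelled out to match the deviation bound at \<epsilon> =
        0.\<close>
      have "measure_pmf.prob (P_unif k n m) {\<phi> \<in> formulas k n m. ?R \<phi>} \<le>
          measure_pmf.prob (replicate_pmf m (map_pmf hd (random_clause (clauses k n))))
            {ls. a \<le> \<bar>collision n ls - 0\<^sup>2 * (1 / real n) * real m * (real m - 1) / 2\<bar>}"
        unfolding P_unif_def by (rule prob_random_formula_le) auto
      also note prob_collision_deviation[OF biased_literal_clauses[OF k] refl a]
      finally show ?thesis by simp
    qed
    have at: "measure_pmf.prob (P_at k n m x) {\<phi> \<in> formulas k n m. \<not> ?R \<phi>} \<le> ?vP / a\<^sup>2" for x
    proof -
      \<comment> \<open>The planted mean is \<open>2 * a\<close>, so falling below \<open>a\<close>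
        is a deviation of more than \<open>a\<close>.\<close>
      have "measure_pmf.prob (P_at k n m x) {\<phi> \<in> formulas k n m. \<not> ?R \<phi>} \<le>
          measure_pmf.prob (replicate_pmf m (map_pmf hd (random_clause (satisfied_clauses k n x))))
            {ls. a \<le> \<bar>collision n ls - 2 * a\<bar>}"
        unfolding P_at_def by (rule prob_random_formula_le) auto
      also note prob_collision_deviation[OF biased_literal_satisfied_clauses[OF k, folded \<epsilon>_def]
          refl a, where m = m, unfolded mean]
      finally show ?thesis .
    qed
    \<comment> \<open>The bound does not depend on \<open>x\<close>, so it survives the
      mixture.\<close>
    have planted: "measure_pmf.prob (P_planted k n m) {\<phi> \<in> formulas k n m. \<not> ?R \<phi>} \<le> ?vP / a\<^sup>2"
      unfolding P_planted_def
      by (rule prob_bind_pmf_le[OF at]) (rule order_trans[OF measure_nonneg at])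
    have "?vU / a\<^sup>2 + ?vP / a\<^sup>2 \<le> \<delta>"
      unfolding a_def
    proof (rule chebyshev_bounds_le[OF n0 _ assms(2) m2])
      show "\<epsilon>\<^sup>2 > 0" using \<epsilon> by simp
      have "(C * sqrt (real n))\<^sup>2 \<le> (real m)\<^sup>2"
        using mn assms(2) \<epsilon> by (intro power_mono) (auto simp: C_def)
      thus "64 * real n / ((\<epsilon>\<^sup>2)\<^sup>2 * \<delta>) \<le> (real m)\<^sup>2"
        using assms(2) by (simp add: C_def power_mult_distrib power_divide)
      show "32 / (\<epsilon>\<^sup>2 * \<delta>) \<le> real m"
        using m by (simp add: N_def)
    qed
    moreover note neyman_pearson[OF k, of m ?R]
    moreover note unif planted
    ultimately have "measure_pmf.prob (P_unif k n m) {\<phi> \<in> formulas k n m. Psi_LR k n m \<phi> = 1}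
        + measure_pmf.prob (P_planted k n m) {\<phi> \<in> formulas k n m. Psi_LR k n m \<phi> = 0} \<le> \<delta>"
      by linarith
    \<comment> \<open>Both errors are nonnegative, so their maximum is at most their sum.\<close>
    thus ?thesis
      using measure_nonneg[of "measure_pmf (P_unif k n m)"] measure_nonneg[of "measure_pmf (P_planted k n m)"]
      by (smt (verit))
  qed
  moreover have "C > 0" using assms(2) \<epsilon> by (simp add: C_def)
  ultimately show ?thesis by blast
qed

end
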